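(* Let $k,m$ be positive integers. If a finite graph $G$ is strongly $k$-choosable, then it is strongly $km$-choosable as well.
   Context: A graph $H=(V,E)$ is $k$-choosable if for every family of sets $\{S(v):v\in V\}$ with $|S(v)|=k$ there is a proper vertex coloring assigning to each $v$ a color from $S(v)$. A graph $G=(V,E)$ is strongly $k$-choosable if every graph obtained from $G$ by adding to it (the edges of) a union of pairwise vertex-disjoint cliques, each of size at most $k$, on the vertex set $V$ is $k$-choosable. *)

theory Defs
  imports "HOL-Library.Countable_Set" "HOL-Library.Disjoint_Sets" "HOL-Library.Ramsey"
begin

definition simple_graph :: "'a set \<Rightarrow> 'a set set \<Rightarrow> bool" where
  "simple_graph V E \<longleftrightarrow> E \<subseteq> [V]\<^bsup>2\<^esup>"

definition proper_coloring :: "'a set \<Rightarrow> 'a set set \<Rightarrow> ('a \<Rightarrow> 'c) \<Rightarrow> bool" where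
  "proper_coloring V E c \<longleftrightarrow> (\<forall>u\<in>V. \<forall>v\<in>V. {u, v} \<in> E \<longrightarrow> c u \<noteq> c v)"

text \<open>
  Colors are natural numbers, since a definition cannot quantify over the type of colors.
  For a finite vertex set this is no restriction: see \<open>choosable_any_colors\<close>.
\<close>

definition choosable :: "nat \<Rightarrow> 'a set \<Rightarrow> 'a set set \<Rightarrow> bool" where
  "choosable k V E \<longleftrightarrow>
    (\<forall>S :: 'a \<Rightarrow> nat set. (\<forall>v\<in>V. finite (S v) \<and> card (S v) = k) \<longrightarrow>
      (\<exists>c. proper_coloring V E c \<and> (\<forall>v\<in>V. c v \<in> S v)))"

text \<open>
  \<open>Q\<close> is the family of vertex sets of the added cliques; an added edge may already be in \<open>E\<close>,
  and the cliques need not cover \<open>V\<close>.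
\<close>

definition strongly_choosable :: "nat \<Rightarrow> 'a set \<Rightarrow> 'a set set \<Rightarrow> bool" where
  "strongly_choosable k V E \<longleftrightarrow>
    (\<forall>Q. disjoint Q \<and> (\<forall>A\<in>Q. A \<subseteq> V \<and> finite A \<and> card A \<le> k) \<longrightarrow>
      choosable k V (E \<union> (\<Union>A\<in>Q. [A]\<^bsup>2\<^esup>)))"

lemma choosable_any_colors:
  fixes S :: "'a \<Rightarrow> 'c set"
  assumes "finite V" and "choosable k V E"
    and S: "\<And>v. v \<in> V \<Longrightarrow> finite (S v) \<and> card (S v) = k"
  shows "\<exists>c. proper_coloring V E c \<and> (\<forall>v\<in>V. c v \<in> S v)"
proof -
  define U where "U = (\<Union>v\<in>V. S v)"
  have "finite U" using assms(1) S by (simp add: U_def)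
  then obtain f :: "'c \<Rightarrow> nat" where f: "inj_on f U"
    by (rule countableE[OF countable_finite])
  have "\<forall>v\<in>V. finite (f ` S v) \<and> card (f ` S v) = k"
  proof
    fix v assume v: "v \<in> V"
    then have "inj_on f (S v)" using f by (auto simp: U_def intro: inj_on_subset)
    then show "finite (f ` S v) \<and> card (f ` S v) = k"
      using S[OF v] by (simp add: card_image)
  qed
  then obtain d where d: "proper_coloring V E d" "\<forall>v\<in>V. d v \<in> f ` S v"
    using assms(2)[unfolded choosable_def, rule_format, of "\<lambda>v. f ` S v"] by auto
  have "\<forall>v\<in>V. \<exists>x. x \<in> S v \<and> d v = f x"
    using d(2) by auto
  then obtain c where c: "\<forall>v\<in>V. c v \<in> S v \<and> d v = f (c v)"
    by (rule bchoice[THEN exE])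
  have "proper_coloring V E c"
    unfolding proper_coloring_def
  proof (intro ballI impI)
    fix u v assume "u \<in> V" "v \<in> V" "{u, v} \<in> E"
    then have "d u \<noteq> d v" using d(1) by (simp add: proper_coloring_def)
    then show "c u \<noteq> c v" using c \<open>u \<in> V\<close> \<open>v \<in> V\<close> by auto
  qed
  with c show ?thesis by blast
qed

end

theory Submission
  imports Defs
begin

text \<open>
  It suffices to split each added clique into parts of size at most \<open>k\<close> and to shrink the lists
  to size \<open>k\<close> so that lists of vertices in different parts of the same clique are disjoint: a
  coloring from these lists of the graph with the smaller cliques added is then proper for the
  original one. The parts are split off one at a time. Let colors be added to a set \<open>C\<close> one by
  one until at least \<open>k\<close> vertices have at least \<open>k\<close> colors in \<open>C\<close>. At most \<open>k\<close> vertices have more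
  than \<open>k\<close> colors in \<open>C\<close>, as they had at least \<open>k\<close> one step earlier. So a part of exactly \<open>k\<close>
  vertices can be chosen that contains all of those, and giving \<open>C\<close> to this part costs every
  other vertex at most \<open>k\<close> colors.
\<close>

lemma split_off_part:
  fixes S :: "'a \<Rightarrow> 'c set"
  assumes A: "finite A" "k \<le> card A"
    and S: "\<And>v. v \<in> A \<Longrightarrow> finite (S v)" "\<And>v. v \<in> A \<Longrightarrow> k \<le> card (S v)"
  obtains C W where "W \<subseteq> A" "card W = k"
    "\<And>v. v \<in> W \<Longrightarrow> k \<le> card (S v \<inter> C)"
    "\<And>v. v \<in> A - W \<Longrightarrow> card (S v \<inter> C) \<le> k"
proof -
  define rich where "rich C = {v \<in> A. k \<le> card (S v \<inter> C)}" for C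
  define F where "F = {C \<in> Pow (\<Union>v\<in>A. S v). k \<le> card (rich C)}"
  have "S v \<inter> (\<Union>v\<in>A. S v) = S v" if "v \<in> A" for v
    using that by blast
  then have "rich (\<Union>v\<in>A. S v) = A"
    using S(2) by (auto simp: rich_def)
  then have "(\<Union>v\<in>A. S v) \<in> F"
    using A(2) by (simp add: F_def)
  moreover have "finite F"
    using A(1) S(1) by (simp add: F_def)
  ultimately obtain C where C: "C \<in> F" and min: "\<And>D. D \<in> F \<Longrightarrow> D \<subseteq> C \<Longrightarrow> C = D"
    using finite_has_minimal[of F] by blast
  define H where "H = {v \<in> A. k < card (S v \<inter> C)}"
  have "card H \<le> k"
  proof (cases "C = {}")
    case True
    then show ?thesis by (simp add: H_def)
  next
    case False
    then obtain x where x: "x \<in> C" by blast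
    \<comment> \<open>Dropping \<open>x\<close> costs a vertex at most one color, and minimality
      leaves fewer than \<open>k\<close> vertices rich afterwards.\<close>
    have "H \<subseteq> rich (C - {x})"
    proof
      fix v assume v: "v \<in> H"
      have "card (S v \<inter> C) - 1 \<le> card (S v \<inter> C - {x})"
        using diff_card_le_card_Diff[of "{x}" "S v \<inter> C"] by simp
      then show "v \<in> rich (C - {x})"
        using v by (auto simp: H_def rich_def Int_Diff)
    qed
    then have "card H \<le> card (rich (C - {x}))"
      using A(1) by (intro card_mono) (auto simp: rich_def)
    moreover have "C - {x} \<notin> F"
      using min[of "C - {x}"] x by blast
    then have "card (rich (C - {x})) < k"
      using C by (auto simp: F_def)
    ultimately show ?thesis by simp
  qed
  moreover have "k \<le> card (rich C)"
    using C by (simp add: F_def)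
  moreover have "H \<subseteq> rich C" "finite (rich C)"
    using A(1) by (auto simp: H_def rich_def)
  \<comment> \<open>\<open>W \<subseteq> rich C\<close> gives the part enough colors within
    \<open>C\<close>; \<open>H \<subseteq> W\<close> keeps the loss outside the part at most
    \<open>k\<close>.\<close>
  ultimately obtain W where W: "H \<subseteq> W" "W \<subseteq> rich C" "card W = k"
    using exists_subset_between by metis
  show thesis
  proof
    show "W \<subseteq> A" "card W = k" and "\<And>v. v \<in> W \<Longrightarrow> k \<le> card (S v \<inter> C)"
      using W by (auto simp: rich_def)
    show "card (S v \<inter> C) \<le> k" if "v \<in> A - W" for v
      using that W(1) by (auto simp: H_def not_less)
  qed
qed

text \<open>The parts of a clique \<open>A\<close> are encoded as the level sets of a labelling
  \<open>p\<close>, which are disjoint automatically and may be empty; \<open>T\<close> gives the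
  shrunken lists.\<close>

definition list_splitting ::
    "nat \<Rightarrow> ('a \<Rightarrow> 'c set) \<Rightarrow> 'a set \<Rightarrow> ('a \<Rightarrow> nat) \<Rightarrow> ('a \<Rightarrow> 'c set) \<Rightarrow> bool" where
  "list_splitting k S A p T \<longleftrightarrow>
    (\<forall>v\<in>A. T v \<subseteq> S v \<and> card (T v) = k) \<and>
    (\<forall>i. card {v \<in> A. p v = i} \<le> k) \<and>
    (\<forall>u\<in>A. \<forall>v\<in>A. p u \<noteq> p v \<longrightarrow> T u \<inter> T v = {})"

text \<open>Induction on \<open>m\<close>, splitting off one part per step. Lists may be longer than
  \<open>k * m\<close> because deleting \<open>C\<close> shortens them unevenly, and the bound on
  \<open>p\<close> keeps the label \<open>m\<close> free for the next part.\<close>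

lemma list_splitting_exists:
  fixes S :: "'a \<Rightarrow> 'c set"
  assumes "finite A" "card A \<le> k * m"
    and "\<And>v. v \<in> A \<Longrightarrow> finite (S v)" "\<And>v. v \<in> A \<Longrightarrow> k * m \<le> card (S v)"
  shows "\<exists>p T. list_splitting k S A p T \<and> (\<forall>v\<in>A. p v < m)"
  using assms
proof (induction m arbitrary: A S)
  case 0
  then show ?case by (simp add: list_splitting_def)
next
  case (Suc m)
  obtain C W where W: "W \<subseteq> A" "card W \<le> k" "card (A - W) \<le> k * m"
    and C: "\<And>v. v \<in> W \<Longrightarrow> k \<le> card (S v \<inter> C)"
      "\<And>v. v \<in> A - W \<Longrightarrow> card (S v \<inter> C) \<le> k"
  \<comment> \<open>A small clique is a single part that receives all colors, so no vertex is left
    over.\<close>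
  proof (cases "card A \<le> k")
    case True
    have "k \<le> card (S v)" if "v \<in> A" for v
      using Suc.prems(4)[OF that] by simp
    with True show thesis by (intro that[of A UNIV]) auto
  next
    case False
    have "k \<le> card (S v)" if "v \<in> A" for v
      using Suc.prems(4)[OF that] by simp
    with False Suc.prems obtain C W where *: "W \<subseteq> A" "card W = k"
      "\<And>v. v \<in> W \<Longrightarrow> k \<le> card (S v \<inter> C)"
      "\<And>v. v \<in> A - W \<Longrightarrow> card (S v \<inter> C) \<le> k"
      using split_off_part[of A k S] by (metis nat_le_linear)
    moreover have "card (A - W) \<le> k * m"
      using * Suc.prems(1,2) by (simp add: card_Diff_subset finite_subset)
    ultimately show thesis by (intro that[of W C]) auto
  qed
  \<comment> \<open>A list of at least \<open>k * Suc m\<close> colors loses at most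
    \<open>k\<close> of them to \<open>C\<close>.\<close>
  have "k * m \<le> card (S v - C)" if "v \<in> A - W" for v
    using Suc.prems(3,4)[of v] C(2)[OF that] that by (simp add: card_Diff_subset_Int)
  then obtain p T where "list_splitting k (\<lambda>v. S v - C) (A - W) p T" "\<forall>v\<in>A - W. p v < m"
    using Suc.IH[of "A - W" "\<lambda>v. S v - C"] Suc.prems(1,3) W(3) by auto
  then have T: "\<forall>v\<in>A - W. p v < m \<and> T v \<subseteq> S v - C \<and> card (T v) = k"
    and p: "\<forall>i. card {v \<in> A - W. p v = i} \<le> k"
    and disj: "\<forall>u\<in>A - W. \<forall>v\<in>A - W. p u \<noteq> p v \<longrightarrow> T u \<inter> T v = {}"
    by (auto simp: list_splitting_def)
  have "\<forall>v\<in>W. \<exists>X. X \<subseteq> S v \<inter> C \<and> card X = k"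
    using C(1) by (meson obtain_subset_with_card_n)
  then obtain R where R: "\<forall>v\<in>W. R v \<subseteq> S v \<inter> C \<and> card (R v) = k"
    by metis
  define p' where "p' v = (if v \<in> W then m else p v)" for v
  define T' where "T' v = (if v \<in> W then R v else T v)" for v
  have "card {v \<in> A. p' v = i} \<le> k" for i
  proof (cases "i = m")
    case True
    then have "{v \<in> A. p' v = i} = W"
      using W(1) T by (auto simp: p'_def)
    then show ?thesis using W(2) by simp
  next
    case False
    then have "{v \<in> A. p' v = i} = {v \<in> A - W. p v = i}"
      by (auto simp: p'_def)
    then show ?thesis using p by simp
  qed
  moreover have "\<forall>v\<in>A. p' v < Suc m \<and> T' v \<subseteq> S v \<and> card (T' v) = k"
    using T R by (auto simp: p'_def T'_def less_Suc_eq)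
  moreover have "\<forall>u\<in>A. \<forall>v\<in>A. p' u \<noteq> p' v \<longrightarrow> T' u \<inter> T' v = {}"
  proof (intro ballI impI)
    fix u v assume uv: "u \<in> A" "v \<in> A" "p' u \<noteq> p' v"
    \<comment> \<open>Vertices with different labels are not both in \<open>W\<close>. If exactly
      one is, \<open>C\<close> separates their lists; otherwise the induction hypothesis
      applies.\<close>
    have in_C: "T' w \<subseteq> C" if "w \<in> W" for w
      using that R by (auto simp: T'_def)
    have out_C: "T' w \<inter> C = {}" if "w \<in> A - W" for w
      using that T by (auto simp: T'_def)
    show "T' u \<inter> T' v = {}"
    proof (cases "u \<in> W \<or> v \<in> W")
      case True
      then show ?thesis
        using uv in_C[of u] in_C[of v] out_C[of u] out_C[of v]
        by (auto simp: p'_def split: if_splits)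
    next
      case False
      then show ?thesis using uv disj by (simp add: p'_def T'_def)
    qed
  qed
  ultimately show ?case unfolding list_splitting_def by blast
qed

theorem theorem7p2:
  fixes V :: "'a set" and E :: "'a set set" and k m :: nat
  assumes "finite V" and "simple_graph V E"
    and "k \<ge> 1" and "m \<ge> 1"
    and "strongly_choosable k V E"
  shows "strongly_choosable (k * m) V E"
  unfolding strongly_choosable_def choosable_def
proof (intro allI impI, elim conjE)
  fix Q :: "'a set set" and S :: "'a \<Rightarrow> nat set"
  assume disj: "disjoint Q"
    and Q: "\<forall>A\<in>Q. A \<subseteq> V \<and> finite A \<and> card A \<le> k * m"
    and S: "\<forall>v\<in>V. finite (S v) \<and> card (S v) = k * m"
  have "\<exists>p T. list_splitting k S A p T" if "A \<in> Q" for A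
  proof -
    have "v \<in> V" if "v \<in> A" for v
      using Q \<open>A \<in> Q\<close> that by blast
    then have "finite (S v)" "k * m \<le> card (S v)" if "v \<in> A" for v
      using S that by simp_all
    then show ?thesis
      using Q \<open>A \<in> Q\<close> list_splitting_exists[of A k m S] by blast
  qed
  then obtain p T where split: "\<And>A. A \<in> Q \<Longrightarrow> list_splitting k S A (p A) (T A)"
    by metis
  have T: "T A v \<subseteq> S v \<and> card (T A v) = k" if "A \<in> Q" "v \<in> A" for A v
    using split[OF that(1)] that(2) by (simp add: list_splitting_def)
  have p: "card {v \<in> A. p A v = i} \<le> k" if "A \<in> Q" for A i
    using split[OF that] by (simp add: list_splitting_def)
  have T_disj: "T A u \<inter> T A v = {}" if "A \<in> Q" "u \<in> A" "v \<in> A" "p A u \<noteq> p A v" for A u v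
    using split[OF that(1)] that(2-) by (simp add: list_splitting_def)
  \<comment> \<open>Each vertex lies in at most one clique of \<open>Q\<close>, so the lists chosen
    clique by clique fit together. A vertex in no clique takes any \<open>k\<close> colors of its
    list.\<close>
  have "\<exists>X. X \<subseteq> S v \<and> card X = k \<and> (\<forall>A\<in>Q. v \<in> A \<longrightarrow> X = T A v)" if "v \<in> V" for v
  proof (cases "\<exists>A\<in>Q. v \<in> A")
    case True
    then obtain A where A: "A \<in> Q" "v \<in> A" by blast
    then have "B = A" if "B \<in> Q" "v \<in> B" for B
      using that disj by (auto dest: disjointD)
    then show ?thesis using T[OF A] by blast
  next
    case False
    have "k \<le> card (S v)" using S that \<open>m \<ge> 1\<close> by simp
    then show ?thesis using False by (meson obtain_subset_with_card_n)
  qed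
  then obtain L where L: "\<And>v. v \<in> V \<Longrightarrow> L v \<subseteq> S v \<and> card (L v) = k"
    and L_eq: "\<And>A v. v \<in> V \<Longrightarrow> A \<in> Q \<Longrightarrow> v \<in> A \<Longrightarrow> L v = T A v"
    by metis
  define P where "P = {{v \<in> A. p A v = i} | A i. A \<in> Q}"
  have "disjoint P"
  proof (rule disjointI)
    fix X Y assume XY: "X \<in> P" "Y \<in> P" "X \<noteq> Y"
    then obtain A i B j where AB: "A \<in> Q" "B \<in> Q"
        "X = {v \<in> A. p A v = i}" "Y = {v \<in> B. p B v = j}"
      unfolding P_def by blast
    show "X \<inter> Y = {}"
    proof (cases "A = B")
      case True
      then show ?thesis using AB XY(3) by auto
    next
      case False
      then show ?thesis using AB disjointD[OF disj, of A B] by auto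
    qed
  qed
  moreover have "\<forall>X\<in>P. X \<subseteq> V \<and> finite X \<and> card X \<le> k"
    using Q p by (auto simp: P_def)
  ultimately have "choosable k V (E \<union> (\<Union>X\<in>P. [X]\<^bsup>2\<^esup>))"
    using assms(5) by (simp add: strongly_choosable_def)
  moreover have "finite (L v) \<and> card (L v) = k" if "v \<in> V" for v
    using L[OF that] S that by (auto intro: finite_subset)
  ultimately obtain c where c: "proper_coloring V (E \<union> (\<Union>X\<in>P. [X]\<^bsup>2\<^esup>)) c" "\<forall>v\<in>V. c v \<in> L v"
    using choosable_any_colors[OF assms(1), of k _ L] by blast
  have "c u \<noteq> c v" if uv: "u \<in> V" "v \<in> V" "{u, v} \<in> E \<union> (\<Union>A\<in>Q. [A]\<^bsup>2\<^esup>)" for u v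
  \<comment> \<open>An edge missing from the graph with the smaller cliques joins two parts of one
    clique \<open>A\<close>, where the lists are disjoint.\<close>
  proof (cases "{u, v} \<in> E \<union> (\<Union>X\<in>P. [X]\<^bsup>2\<^esup>)")
    case True
    then show ?thesis using c(1) uv(1,2) unfolding proper_coloring_def by blast
  next
    case False
    then obtain A where A: "A \<in> Q" "{u, v} \<in> [A]\<^bsup>2\<^esup>" using uv(3) by blast
    then have "u \<in> A" "v \<in> A" by (auto simp: nsets_def)
    have "p A u \<noteq> p A v"
    proof
      assume "p A u = p A v"
      then have "{u, v} \<in> [{w \<in> A. p A w = p A u}]\<^bsup>2\<^esup>"
        using A(2) by (auto simp: nsets_def)
      then show False using False A(1) unfolding P_def by blast
    qed
    then have "L u \<inter> L v = {}"
      using T_disj A(1) \<open>u \<in> A\<close> \<open>v \<in> A\<close> L_eq uv by simp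
    then show ?thesis using c(2) uv by force
  qed
  moreover have "\<forall>v\<in>V. c v \<in> S v"
    using c(2) L by blast
  ultimately show "\<exists>c. proper_coloring V (E \<union> (\<Union>A\<in>Q. [A]\<^bsup>2\<^esup>)) c \<and> (\<forall>v\<in>V. c v \<in> S v)"
    unfolding proper_coloring_def by blast
qed

end
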